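(* Let $n \geqslant m \geqslant 1$ be integers and let $\sigma^m = [\upsilon^0, \upsilon^1, \ldots, \upsilon^m]$ be a regular $m$-simplex in $\mathbb{R}^n$ with barycenter $\kappa^m$. For $i=0,\ldots,m$ let $\sigma^m_{\neg i}$ be the $i$-th $(m-1)$-face of $\sigma^m$, opposite to the vertex $\upsilon^i$, and let $\kappa_i^m$ be its barycenter. Let $\beta_{\rm cir}^m$ and $\beta_{\rm inr}^m$ be the barycentric circumradius and the barycentric inradius of $\sigma^m$. Then: (a) the distance from the barycenter to the $j$-th $(m-1)$-face is given by $\min_{x\in\sigma^m_{\neg j}}\|\kappa^m-x\| = \|\kappa^m-\kappa_j^m\|$ for all $j=0,1,\ldots,m$; (b) $\beta_{\rm cir}^m = \|\upsilon^j-\kappa^m\|$ for all $j=0,1,\ldots,m$; (c) $\beta_{\rm inr}^m = \|\kappa^m-\kappa_j^m\|$ for all $j=0,1,\ldots,m$; (d) $\displaystyle\sum_{i=0}^m\|\kappa^m-\kappa_i^m\| = \beta_{\rm cir}^m+\beta_{\rm inr}^m$.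
   Context: An $m$-simplex $[\upsilon^0,\ldots,\upsilon^m]$ in $\mathbb{R}^n$ is the convex hull of $m+1$ affinely independent points (its vertices). It is regular if all its edges have the same length. Its barycenter is $\kappa^m=\frac1{m+1}\sum_{j=0}^m\upsilon^j$. The face $\sigma^m_{\neg i}$ is the convex hull of all vertices except $\upsilon^i$, with barycenter $\kappa_i^m = \frac1m\sum_{j\neq i}\upsilon^j$. The boundary of $\sigma^m$ is $\vartheta\sigma^m=\bigcup_{i=0}^m\sigma^m_{\neg i}$. The barycentric circumradius $\beta_{\rm cir}^m$ is the smallest radius of a spherical surface in $\mathbb{R}^n$ centered at $\kappa^m$ enclosing $\sigma^m$ (i.e. such that the closed ball it bounds contains $\sigma^m$). The barycentric inradius is $\beta_{\rm inr}^m=\min_{x\in\vartheta\sigma^m}\|\kappa^m-x\|$. $\|\cdot\|$ is the Euclidean norm. *)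

theory Defs
  imports "HOL-Analysis.Analysis"
begin

text \<open>
  An \<open>m\<close>-simplex is given by its vertices \<open>v 0, \<dots>, v m\<close>; the values of \<open>v\<close> beyond
  \<open>m\<close> are irrelevant.  Injectivity is required separately, since \<^const>\<open>affine_dependent\<close>
  speaks about the set of vertices and does not see repetitions.
\<close>

definition simplex_vertices :: "nat \<Rightarrow> (nat \<Rightarrow> real ^ 'n) \<Rightarrow> bool" where
  "simplex_vertices m v \<longleftrightarrow> inj_on v {..m} \<and> \<not> affine_dependent (v ` {..m})"

definition simplex_hull :: "nat \<Rightarrow> (nat \<Rightarrow> real ^ 'n) \<Rightarrow> (real ^ 'n) set" where
  "simplex_hull m v = convex hull (v ` {..m})"

definition regular_simplex :: "nat \<Rightarrow> (nat \<Rightarrow> real ^ 'n) \<Rightarrow> bool" where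
  "regular_simplex m v \<longleftrightarrow> simplex_vertices m v \<and>
     (\<exists>l. \<forall>i\<le>m. \<forall>j\<le>m. i \<noteq> j \<longrightarrow> norm (v i - v j) = l)"

definition simplex_barycenter :: "nat \<Rightarrow> (nat \<Rightarrow> real ^ 'n) \<Rightarrow> real ^ 'n" where
  "simplex_barycenter m v = (1 / real (m + 1)) *\<^sub>R (\<Sum>j\<le>m. v j)"

definition simplex_face :: "nat \<Rightarrow> (nat \<Rightarrow> real ^ 'n) \<Rightarrow> nat \<Rightarrow> (real ^ 'n) set" where
  "simplex_face m v i = convex hull (v ` ({..m} - {i}))"

definition face_barycenter :: "nat \<Rightarrow> (nat \<Rightarrow> real ^ 'n) \<Rightarrow> nat \<Rightarrow> real ^ 'n" where
  "face_barycenter m v i = (1 / real m) *\<^sub>R (\<Sum>j\<in>{..m} - {i}. v j)"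

definition simplex_boundary :: "nat \<Rightarrow> (nat \<Rightarrow> real ^ 'n) \<Rightarrow> (real ^ 'n) set" where
  "simplex_boundary m v = (\<Union>i\<le>m. simplex_face m v i)"

text \<open>
  \<^const>\<open>Least\<close> on the reals is a genuine minimum (not an infimum): its value is
  unspecified unless the minimum is attained.
\<close>

definition min_dist :: "real ^ 'n \<Rightarrow> (real ^ 'n) set \<Rightarrow> real" where
  "min_dist p S = (LEAST d. d \<in> (\<lambda>x. norm (p - x)) ` S)"

definition barycentric_circumradius :: "nat \<Rightarrow> (nat \<Rightarrow> real ^ 'n) \<Rightarrow> real" where
  "barycentric_circumradius m v =
     (LEAST r. 0 \<le> r \<and> simplex_hull m v \<subseteq> cball (simplex_barycenter m v) r)"

definition barycentric_inradius :: "nat \<Rightarrow> (nat \<Rightarrow> real ^ 'n) \<Rightarrow> real" where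
  "barycentric_inradius m v = min_dist (simplex_barycenter m v) (simplex_boundary m v)"

end

theory Submission
  imports Defs
begin

text \<open>
  Put \<open>w i = v i - \<kappa>\<close>, so that \<open>\<Sum>i. w i = 0\<close>. Summing \<open>\<parallel>w i - w j\<parallel>\<^sup>2 = l\<^sup>2\<close> over \<open>j\<close> shows that all \<open>w i\<close> have
  the same norm \<open>R\<close>, and pairing \<open>w j\<close> with \<open>\<Sum>i. w i = 0\<close> gives \<open>w i \<bullet> w j = - R\<^sup>2 / m\<close> for \<open>i \<noteq> j\<close>.
  Thus the face opposite to \<open>v j\<close> lies in the hyperplane \<open>(x - \<kappa>) \<bullet> w j = - R\<^sup>2 / m\<close>, at distance
  \<open>R / m\<close> from \<open>\<kappa>\<close>, and its point closest to \<open>\<kappa>\<close> is \<open>\<kappa> - w j / m\<close>, the barycenter of the face. Hence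
  the circumradius is \<open>R\<close>, the inradius is \<open>R / m\<close>, and \<open>(m + 1) (R / m) = R + R / m\<close>.
\<close>

lemma equidistant_sum_zero_norm:
  fixes w :: "'a \<Rightarrow> 'b :: real_inner"
  assumes "finite I"
    and sum0: "(\<Sum>i\<in>I. w i) = 0"
    and dist: "\<And>i j. i \<in> I \<Longrightarrow> j \<in> I \<Longrightarrow> i \<noteq> j \<Longrightarrow> norm (w i - w j) = l"
    and "i \<in> I" "j \<in> I"
  shows "norm (w i) = norm (w j)"
proof -
  \<comment> \<open>The right-hand side does not mention \<open>k\<close>, so cancelling
    \<open>card I\<close> makes \<open>w k \<bullet> w k\<close> the same for every index.\<close>
  have eq: "real (card I) * (w k \<bullet> w k) = real (card I - 1) * l\<^sup>2 - (\<Sum>p\<in>I. w p \<bullet> w p)"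
    if "k \<in> I" for k
  proof -
    have "(\<Sum>p\<in>I. (norm (w k - w p))\<^sup>2)
        = (\<Sum>p\<in>I. w k \<bullet> w k + w p \<bullet> w p - 2 * (w k \<bullet> w p))"
      by (simp add: power2_norm_eq_inner inner_commute algebra_simps)
    also have "\<dots> = real (card I) * (w k \<bullet> w k) + (\<Sum>p\<in>I. w p \<bullet> w p) - 2 * (w k \<bullet> (\<Sum>p\<in>I. w p))"
      by (simp add: sum.distrib sum_subtractf inner_sum_right sum_distrib_left)
    finally have "(\<Sum>p\<in>I. (norm (w k - w p))\<^sup>2) = real (card I) * (w k \<bullet> w k) + (\<Sum>p\<in>I. w p \<bullet> w p)"
      using sum0 by simp
    \<comment> \<open>The term at \<open>p = k\<close> is zero, hence \<open>card I - 1\<close>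
      copies of \<open>l\<^sup>2\<close>.\<close>
    moreover have "(\<Sum>p\<in>I - {k}. (norm (w k - w p))\<^sup>2) = (\<Sum>p\<in>I - {k}. l\<^sup>2)"
      using that dist by (intro sum.cong) auto
    then have "(\<Sum>p\<in>I. (norm (w k - w p))\<^sup>2) = (\<Sum>p\<in>I - {k}. l\<^sup>2)"
      using that \<open>finite I\<close> by (simp add: sum.remove[of I k])
    ultimately show ?thesis
      using that \<open>finite I\<close> by simp
  qed
  have "card I \<noteq> 0"
    using assms by auto
  with eq[OF \<open>i \<in> I\<close>] eq[OF \<open>j \<in> I\<close>] have "w i \<bullet> w i = w j \<bullet> w j"
    by (metis mult_left_cancel of_nat_eq_0_iff)
  then show ?thesis
    by (simp add: norm_eq_sqrt_inner)
qed

lemma equidistant_sum_zero_inner: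
  fixes w :: "'a \<Rightarrow> 'b :: real_inner"
  assumes "finite I"
    and sum0: "(\<Sum>i\<in>I. w i) = 0"
    and dist: "\<And>i j. i \<in> I \<Longrightarrow> j \<in> I \<Longrightarrow> i \<noteq> j \<Longrightarrow> norm (w i - w j) = l"
    and "i \<in> I" "j \<in> I" "i \<noteq> j"
  shows "real (card I - 1) * (w i \<bullet> w j) = - (norm (w j))\<^sup>2"
proof -
  \<comment> \<open>Polarization with equal norms: the inner product with \<open>w j\<close> is the
    same for all \<open>p\<close> other than \<open>j\<close>, so below each such term may be
    replaced by \<open>w i \<bullet> w j\<close>.\<close>
  have inner: "w p \<bullet> w j = (norm (w j))\<^sup>2 - l\<^sup>2 / 2" if "p \<in> I" "p \<noteq> j" for p
  proof -
    have "norm (w p) = norm (w j)"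
      using equidistant_sum_zero_norm[OF assms(1-3)] that \<open>j \<in> I\<close> by blast
    then have "l\<^sup>2 = 2 * (norm (w j))\<^sup>2 - 2 * (w p \<bullet> w j)"
      using dot_norm_neg[of "w p" "w j"] dist[OF that(1) \<open>j \<in> I\<close> that(2)] by simp
    then show ?thesis by linarith
  qed
  have "0 = (\<Sum>p\<in>I. w p) \<bullet> w j"
    using sum0 by simp
  also have "\<dots> = (\<Sum>p\<in>I. w p \<bullet> w j)"
    by (rule inner_sum_left)
  also have "\<dots> = w j \<bullet> w j + (\<Sum>p\<in>I - {j}. w p \<bullet> w j)"
    using \<open>finite I\<close> \<open>j \<in> I\<close> by (rule sum.remove)
  also have "(\<Sum>p\<in>I - {j}. w p \<bullet> w j) = (\<Sum>p\<in>I - {j}. w i \<bullet> w j)"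
    using inner assms(4,6) by (intro sum.cong) auto
  finally show ?thesis
    using \<open>finite I\<close> \<open>j \<in> I\<close> by (simp add: power2_norm_eq_inner)
qed

lemma sum_simplex_barycenter: "(\<Sum>i\<le>m. v i - simplex_barycenter m v) = 0"
proof -
  have "real (m + 1) *\<^sub>R simplex_barycenter m v = (\<Sum>j\<le>m. v j)"
    unfolding simplex_barycenter_def by simp
  then show ?thesis
    by (simp add: sum_subtractf sum_constant_scaleR del: sum_constant)
qed

text \<open>Removing \<open>v j\<close> from the vertex sum leaves \<open>m\<close> times the face
  barycenter. This reduces every claim about face barycenters to the vectors
  \<open>v j - simplex_barycenter m v\<close>.\<close>

lemma barycenter_minus_face_barycenter:
  assumes "1 \<le> m" "j \<le> m"
  shows "simplex_barycenter m v - face_barycenter m v j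
    = (1 / real m) *\<^sub>R (v j - simplex_barycenter m v)"
proof -
  let ?k = "simplex_barycenter m v"
  have "(\<Sum>i\<in>{..m} - {j}. v i) = (\<Sum>i\<le>m. v i) - v j"
    using assms by (simp add: sum.remove[of "{..m}" j])
  also have "(\<Sum>i\<le>m. v i) = real (m + 1) *\<^sub>R ?k"
    unfolding simplex_barycenter_def by simp
  finally have "real m *\<^sub>R face_barycenter m v j = real (m + 1) *\<^sub>R ?k - v j"
    using assms unfolding face_barycenter_def by simp
  then have "real m *\<^sub>R (?k - face_barycenter m v j) = v j - ?k"
    by (simp add: algebra_simps)
  moreover have "?k - face_barycenter m v j
      = (1 / real m) *\<^sub>R (real m *\<^sub>R (?k - face_barycenter m v j))"
    using assms by simp
  ultimately show ?thesis
    by simp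
qed

text \<open>A convex combination of the \<open>m\<close> face vertices with equal weights.
  Membership shows that the minimum in \<open>min_dist\<close> is attained.\<close>

lemma face_barycenter_in_face:
  assumes "1 \<le> m" "j \<le> m"
  shows "face_barycenter m v j \<in> simplex_face m v j"
  unfolding face_barycenter_def simplex_face_def scaleR_sum_right
  using assms by (intro convex_sum) (auto intro: hull_inc)

lemma regular_simplex_norm_vertex:
  assumes "regular_simplex m v" "i \<le> m" "j \<le> m"
  shows "norm (v i - simplex_barycenter m v) = norm (v j - simplex_barycenter m v)"
proof -
  obtain l where "\<And>i j. i \<le> m \<Longrightarrow> j \<le> m \<Longrightarrow> i \<noteq> j \<Longrightarrow> norm (v i - v j) = l"
    using assms(1) unfolding regular_simplex_def by blast
  then show ?thesis
    using assms(2,3)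
    by (intro equidistant_sum_zero_norm[where I = "{..m}" and l = l])
      (simp_all add: sum_simplex_barycenter)
qed

text \<open>The vertices of the face satisfy this linear equation and a hyperplane is convex, so it
  contains their hull. Writing the barycenter minus \<open>x\<close> makes the right-hand side
  nonnegative, ready for Cauchy-Schwarz.\<close>

lemma regular_simplex_face_hyperplane:
  assumes "1 \<le> m" "regular_simplex m v" "j \<le> m" "x \<in> simplex_face m v j"
  shows "(simplex_barycenter m v - x) \<bullet> (v j - simplex_barycenter m v)
    = (norm (v j - simplex_barycenter m v))\<^sup>2 / real m"
proof -
  let ?k = "simplex_barycenter m v"
  let ?w = "v j - ?k"
  \<comment> \<open>The constant term once the hyperplane is put in the form
    \<open>?w \<bullet> y = ?c\<close>.\<close>
  let ?c = "?w \<bullet> ?k - (norm ?w)\<^sup>2 / real m"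
  obtain l where l: "\<And>i j. i \<le> m \<Longrightarrow> j \<le> m \<Longrightarrow> i \<noteq> j \<Longrightarrow> norm (v i - v j) = l"
    using assms(2) unfolding regular_simplex_def by blast
  have "?w \<bullet> v i = ?c" if "i \<le> m" "i \<noteq> j" for i
  proof -
    have "real (card {..m} - 1) * ((v i - ?k) \<bullet> ?w) = - (norm ?w)\<^sup>2"
      using l that assms(3)
      by (intro equidistant_sum_zero_inner[where l = l and w = "\<lambda>i. v i - ?k"])
        (simp_all add: sum_simplex_barycenter)
    then have "(v i - ?k) \<bullet> ?w = - (norm ?w)\<^sup>2 / real m"
      using assms(1) by (simp add: field_simps)
    then show ?thesis
      by (simp add: inner_commute algebra_simps)
  qed
  then have "simplex_face m v j \<subseteq> {y. ?w \<bullet> y = ?c}"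
    unfolding simplex_face_def by (intro hull_minimal convex_hyperplane) auto
  then have "?w \<bullet> x = ?c"
    using assms(4) by blast
  then show ?thesis
    by (simp add: inner_commute algebra_simps)
qed

text \<open>Cauchy-Schwarz applied to the hyperplane equation, then division by
  \<open>norm (v j - simplex_barycenter m v)\<close>; the case split covers a zero divisor, where
  the left-hand side vanishes.\<close>

lemma norm_face_barycenter_le:
  assumes "1 \<le> m" "regular_simplex m v" "j \<le> m" "x \<in> simplex_face m v j"
  shows "norm (simplex_barycenter m v - face_barycenter m v j) \<le> norm (simplex_barycenter m v - x)"
proof (cases "v j = simplex_barycenter m v")
  case True
  then show ?thesis
    using assms by (simp add: barycenter_minus_face_barycenter)
next
  case False
  let ?k = "simplex_barycenter m v"
  have "norm (v j - ?k) * (norm (v j - ?k) / real m) = (?k - x) \<bullet> (v j - ?k)"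
    using regular_simplex_face_hyperplane[OF assms] by (simp add: power2_eq_square)
  also have "\<dots> \<le> norm (v j - ?k) * norm (?k - x)"
    by (metis mult.commute norm_cauchy_schwarz)
  finally have "norm (v j - ?k) / real m \<le> norm (?k - x)"
    using False by (simp only: mult_le_cancel_left_pos zero_less_norm_iff right_minus_eq not_False_eq_True)
  then show ?thesis
    using assms by (simp add: barycenter_minus_face_barycenter)
qed

lemma min_dist_eqI:
  assumes "y \<in> S" "\<And>x. x \<in> S \<Longrightarrow> norm (p - y) \<le> norm (p - x)"
  shows "min_dist p S = norm (p - y)"
  unfolding min_dist_def using assms by (intro Least_equality) auto

theorem theorem2p33:
  fixes v :: "nat \<Rightarrow> real ^ 'n" and m :: nat
  assumes "1 \<le> m" and "m \<le> CARD('n)"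
    and "regular_simplex m v"
  shows
    "(\<forall>j\<le>m. min_dist (simplex_barycenter m v) (simplex_face m v j)
        = norm (simplex_barycenter m v - face_barycenter m v j)) \<and>
     (\<forall>j\<le>m. barycentric_circumradius m v = norm (v j - simplex_barycenter m v)) \<and>
     (\<forall>j\<le>m. barycentric_inradius m v
        = norm (simplex_barycenter m v - face_barycenter m v j)) \<and>
     (\<Sum>i\<le>m. norm (simplex_barycenter m v - face_barycenter m v i))
        = barycentric_circumradius m v + barycentric_inradius m v"
proof -
  let ?k = "simplex_barycenter m v"
  obtain R where R: "norm (v j - ?k) = R" if "j \<le> m" for j
    using regular_simplex_norm_vertex[OF assms(3)] by blast
  have face: "norm (?k - face_barycenter m v j) = R / real m" if "j \<le> m" for j
    using assms(1) that by (simp add: barycenter_minus_face_barycenter R)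
  have a: "min_dist ?k (simplex_face m v j) = norm (?k - face_barycenter m v j)" if "j \<le> m" for j
    using assms that by (intro min_dist_eqI face_barycenter_in_face norm_face_barycenter_le)
  have b: "barycentric_circumradius m v = R"
    unfolding barycentric_circumradius_def
  proof (rule Least_equality)
    \<comment> \<open>Balls are convex, so checking the vertices suffices.\<close>
    have "v ` {..m} \<subseteq> cball ?k R"
      by (auto simp: dist_norm norm_minus_commute R)
    moreover have "0 \<le> R"
      using R[of 0] norm_ge_zero[of "v 0 - ?k"] by simp
    ultimately show "0 \<le> R \<and> simplex_hull m v \<subseteq> cball ?k R"
      unfolding simplex_hull_def by (simp add: hull_minimal)
  next
    fix r
    assume "0 \<le> r \<and> simplex_hull m v \<subseteq> cball ?k r"
    \<comment> \<open>A vertex at distance exactly \<open>R\<close> forces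
      \<open>R \<le> r\<close>.\<close>
    moreover have "v 0 \<in> simplex_hull m v"
      unfolding simplex_hull_def by (simp add: hull_inc)
    ultimately show "R \<le> r"
      using R[of 0] by (auto simp: dist_norm norm_minus_commute)
  qed
  have c: "barycentric_inradius m v = R / real m"
  proof -
    have "barycentric_inradius m v = norm (?k - face_barycenter m v 0)"
      unfolding barycentric_inradius_def
    proof (rule min_dist_eqI)
      show "face_barycenter m v 0 \<in> simplex_boundary m v"
        unfolding simplex_boundary_def using face_barycenter_in_face[OF assms(1), of 0 v] by blast
    next
      fix x
      assume "x \<in> simplex_boundary m v"
      then obtain j where "j \<le> m" "x \<in> simplex_face m v j"
        unfolding simplex_boundary_def by blast
      \<comment> \<open>All face barycenters are at distance \<open>R / real m\<close>, so index 0
        can be exchanged for the \<open>j\<close> whose face contains \<open>x\<close>.\<close>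
      then show "norm (?k - face_barycenter m v 0) \<le> norm (?k - x)"
        using norm_face_barycenter_le[OF assms(1,3)] face by (metis le0)
    qed
    then show ?thesis
      by (simp add: face)
  qed
  have d: "(\<Sum>i\<le>m. norm (?k - face_barycenter m v i)) = R + R / real m"
    using assms(1) by (simp add: face field_simps)
  show ?thesis
    using a b c d R face by simp
qed

end
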